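(* Let the sequence $(b_0,b_1,\ldots)$ be defined by $b_0:=0$ and $b_k:=E_{k-1}(1)$ for $k\ge1$, where $E_j(x)$ are the Euler polynomials. Then for all $n\ge1$, $$H_n(b_k)=(-1)^{n-1}\frac{2^{n+1}}{n!}\cdot\mathcal{H}_{1,n}^{-}\cdot H_n\big(E_k(1)\big),\qquad\text{where}\quad \mathcal{H}_{1,n}^{-}:=\sum_{j=1}^n\frac{(-1)^{j-1}}{j}.$$
   Context: For a sequence $(a_k)_{k\ge 0}$ and $n\ge 0$, $H_n(a_k):=\det(a_{i+j})_{0\le i,j\le n}$ denotes the $(n+1)\times(n+1)$ Hankel determinant. The Euler polynomials are defined by $\frac{2e^{xt}}{e^t+1}=\sum_{n\ge0}E_n(x)\frac{t^n}{n!}$. *)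

theory Defs
  imports "Jordan_Normal_Form.Determinant" "HOL-Computational_Algebra.Formal_Power_Series"
begin

definition euler_gf :: "'a::field_char_0 \<Rightarrow> 'a fps" where
  "euler_gf x = fps_const 2 * fps_exp x / (fps_exp 1 + 1)"

definition euler_poly :: "nat \<Rightarrow> 'a::field_char_0 \<Rightarrow> 'a" where
  "euler_poly n x = fact n * fps_nth (euler_gf x) n"

text \<open>The division in the generating function is exact, since the denominator has
  constant coefficient 2.\<close>

lemma euler_gf_mult:
  "Abs_fps (\<lambda>n. euler_poly n x / fact n) * (fps_exp 1 + 1) = fps_const 2 * fps_exp (x::'a::field_char_0)"
proof -
  have "fps_nth (fps_exp 1 + 1 :: 'a fps) 0 \<noteq> 0"
    by simp
  then have u: "is_unit (fps_exp 1 + 1 :: 'a fps)"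
    by (simp only: fps_is_unit_iff not_False_eq_True)
  have "Abs_fps (\<lambda>n. euler_poly n x / fact n) = euler_gf x"
    by (simp add: fps_eq_iff euler_poly_def)
  with u show ?thesis
    unfolding euler_gf_def by (metis dvd_div_mult_self unit_imp_dvd)
qed

text \<open>The index \<open>n\<close> is the largest row and column index, so the matrix has
  size \<open>n + 1\<close>.\<close>

definition hankel_det :: "(nat \<Rightarrow> 'a::comm_ring_1) \<Rightarrow> nat \<Rightarrow> 'a" where
  "hankel_det a n = det (mat (n + 1) (n + 1) (\<lambda>(i, j). a (i + j)))"

definition alt_harm :: "nat \<Rightarrow> real" where
  "alt_harm n = (\<Sum>j = 1..n. (-1) ^ (j - 1) / real j)"

end

theory Submission
  imports Defs
begin

text \<open>
  Let \<open>L\<close> be the linear functional on polynomials with \<open>L (x ^ k) = E\<^sub>k(1)\<close>. It satisfies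
  \<open>L (p(x + 1)) + L (p(x)) = 2 p(1)\<close>, and from this the monic polynomials
  given by \<open>P\<^sub>n\<^sub>+\<^sub>1 = (x - 1/2) P\<^sub>n + (n\<^sup>2/4) P\<^sub>n\<^sub>-\<^sub>1\<close> are seen to be orthogonal for \<open>L\<close>: they satisfy
  \<open>P\<^sub>n(x) - P\<^sub>n(x - 1) = (n/2) (P\<^sub>n\<^sub>-\<^sub>1(x) + P\<^sub>n\<^sub>-\<^sub>1(x - 1))\<close>, which exhibits \<open>P\<^sub>n\<close> as
  \<open>Q(x) + Q(x - 1)\<close> with \<open>Q(0) = 0\<close>.

  Let \<open>M\<close> be the functional of the sequence \<open>b\<close>, so that \<open>M (x p) = L p\<close> and \<open>M 1 = 0\<close>. In the matrix
  \<open>M (P\<^sub>i x ^ j)\<close> the last row vanishes except for its first entry \<open>M P\<^sub>n\<close>, and deleting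
  the last row and the first column leaves the triangular matrix \<open>L (P\<^sub>i x ^ j)\<close>. Hence
  \<open>H\<^sub>n(b) = (-1) ^ n M(P\<^sub>n) H\<^sub>n\<^sub>-\<^sub>1(E\<^sub>k(1))\<close>, and \<open>M(P\<^sub>n)\<close> obeys the three-term recurrence,
  which is solved by a multiple of the alternating harmonic numbers.
\<close>

section \<open>Moment functionals\<close>

definition moment :: "(nat \<Rightarrow> 'a::comm_ring_1) \<Rightarrow> 'a poly \<Rightarrow> 'a" where
  "moment a p = (\<Sum>k\<le>degree p. coeff p k * a k)"

lemma moment_eq_sum:
  assumes "degree p \<le> N"
  shows "moment a p = (\<Sum>k\<le>N. coeff p k * a k)"
  unfolding moment_def using assms
  by (intro sum.mono_neutral_left) (auto simp: coeff_eq_0)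

lemma moment_add: "moment a (p + q) = moment a p + moment a q"
proof -
  define N where "N = max (degree p) (degree q)"
  have "degree p \<le> N" "degree q \<le> N" "degree (p + q) \<le> N"
    by (auto simp: N_def degree_add_le)
  then show ?thesis
    by (simp add: moment_eq_sum[of _ N] algebra_simps sum.distrib)
qed

lemma moment_smult: "moment a (smult c p) = c * moment a p"
proof -
  have "degree (smult c p) \<le> degree p" "degree p \<le> degree p"
    by (auto simp: degree_smult_le)
  then show ?thesis
    by (simp add: moment_eq_sum[of _ "degree p"] sum_distrib_left mult.assoc)
qed

lemma moment_0 [simp]: "moment a 0 = 0"
  by (simp add: moment_def)

lemma moment_pCons: "moment a (pCons c p) = c * a 0 + moment (\<lambda>k. a (Suc k)) p"
proof -
  have "degree (pCons c p) \<le> Suc (degree p)"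
    by (simp add: degree_pCons_le)
  then show ?thesis
    by (simp add: moment_eq_sum[of _ "Suc (degree p)"] sum.atMost_Suc_shift moment_def del: sum.atMost_Suc)
qed

lemma moment_monom_mult: "moment a (monom 1 j * p) = moment (\<lambda>k. a (k + j)) p"
  by (induction j arbitrary: a) (auto simp: monom_Suc moment_pCons)

lemma moment_monom: "moment a (monom c n) = c * a n"
  by (induction n arbitrary: a) (auto simp: monom_0 monom_Suc moment_pCons)

lemma moment_sum: "moment a (sum f A) = (\<Sum>x\<in>A. moment a (f x))"
  by (induction A rule: infinite_finite_induct) (auto simp: moment_add)

section \<open>Hankel determinants in a monic polynomial basis\<close>

text \<open>Left multiplication by the unitriangular coefficient matrix of the \<open>P i\<close>
  preserves the determinant and turns the Hankel rows into moments of \<open>P i\<close>.\<close>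

lemma hankel_det_eq_det_moment:
  fixes a :: "nat \<Rightarrow> 'a::comm_ring_1"
  assumes deg: "\<And>i. degree (P i) = i" and monic: "\<And>i. coeff (P i) i = 1"
  shows "hankel_det a n = det (mat (n + 1) (n + 1) (\<lambda>(i, j). moment a (monom 1 j * P i)))"
proof -
  define C where "C = mat (n + 1) (n + 1) (\<lambda>(i, k). coeff (P i) k)"
  define A where "A = mat (n + 1) (n + 1) (\<lambda>(i, j). a (i + j))"
  have C: "C \<in> carrier_mat (n + 1) (n + 1)" and A: "A \<in> carrier_mat (n + 1) (n + 1)"
    by (auto simp: C_def A_def)
  have "det C = prod_list (diag_mat C)"
    by (rule det_lower_triangular[OF _ C]) (auto simp: C_def deg coeff_eq_0)
  also have "diag_mat C = map (\<lambda>_. 1) [0..<n + 1]"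
    by (auto simp: diag_mat_def C_def monic simp del: upt_Suc)
  finally have "det C = 1"
    by (simp del: upt_Suc add: map_replicate_const)
  moreover have "C * A = mat (n + 1) (n + 1) (\<lambda>(i, j). moment a (monom 1 j * P i))"
  proof (rule eq_matI)
    fix i j assume "i < dim_row (mat (n + 1) (n + 1) (\<lambda>(i, j). moment a (monom 1 j * P i)))"
      and "j < dim_col (mat (n + 1) (n + 1) (\<lambda>(i, j). moment a (monom 1 j * P i)))"
    then have ij: "i \<le> n" "j \<le> n" by auto
    have "(C * A) $$ (i, j) = (\<Sum>k\<in>{0..<n + 1}. coeff (P i) k * a (k + j))"
      using ij by (simp add: C_def A_def scalar_prod_def)
    also have "\<dots> = (\<Sum>k\<le>n. coeff (P i) k * a (k + j))"
      by (rule sum.cong) auto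
    also have "\<dots> = moment a (monom 1 j * P i)"
      using ij by (simp add: moment_monom_mult moment_eq_sum[of _ n] deg)
    finally show "(C * A) $$ (i, j) = mat (n + 1) (n + 1) (\<lambda>(i, j). moment a (monom 1 j * P i)) $$ (i, j)"
      using ij by simp
  qed (auto simp: C_def A_def)
  ultimately show ?thesis
    using det_mult[OF C A] by (simp add: hankel_det_def A_def)
qed

lemma det_upper_triangular_mat:
  assumes "\<And>i j. j < i \<Longrightarrow> i < m \<Longrightarrow> f (i, j) = (0::'a::comm_ring_1)"
  shows "det (mat m m f) = (\<Prod>i<m. f (i, i))"
proof -
  have "det (mat m m f) = prod_list (diag_mat (mat m m f))"
    by (rule det_upper_triangular[of _ m]) (use assms in auto)
  also have "diag_mat (mat m m f) = map (\<lambda>i. f (i, i)) [0..<m]"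
    by (auto simp: diag_mat_def)
  also have "prod_list \<dots> = (\<Prod>i<m. f (i, i))"
    by (simp add: prod.list_conv_set_nth atLeast0LessThan)
  finally show ?thesis .
qed

locale monic_orthogonal =
  fixes a :: "nat \<Rightarrow> 'a::comm_ring_1" and P :: "nat \<Rightarrow> 'a poly"
  assumes degree_P: "\<And>i. degree (P i) = i"
    and monic_P: "\<And>i. coeff (P i) i = 1"
    and orthogonal: "\<And>i j. j < i \<Longrightarrow> moment a (monom 1 j * P i) = 0"
begin

lemma hankel_det_eq_prod: "hankel_det a n = (\<Prod>i\<le>n. moment a (monom 1 i * P i))"
proof -
  have "hankel_det a n = (\<Prod>i<n + 1. moment a (monom 1 i * P i))"
    unfolding hankel_det_eq_det_moment[OF degree_P monic_P]
    by (subst det_upper_triangular_mat) (auto simp: orthogonal)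
  then show ?thesis
    by (simp add: lessThan_Suc_atMost)
qed

lemma hankel_det_shifted:
  assumes b: "\<And>k. b (Suc k) = a k"
  shows "hankel_det b n = (-1) ^ n * moment b (P n) * (\<Prod>i<n. moment a (monom 1 i * P i))"
proof -
  define B where "B = mat (n + 1) (n + 1) (\<lambda>(i, j). moment b (monom 1 j * P i))"
  \<comment> \<open>Every column of \<open>B\<close> but the first thus consists of
    \<open>a\<close>-moments, to which orthogonality applies.\<close>
  have shift: "moment b (monom 1 (Suc j) * p) = moment a (monom 1 j * p)" for j p
    by (simp add: monom_Suc moment_pCons b)
  have B: "B \<in> carrier_mat (n + 1) (n + 1)"
    by (simp add: B_def)
  have "hankel_det b n = det B"
    unfolding B_def by (rule hankel_det_eq_det_moment[OF degree_P monic_P])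
  also have "\<dots> = (\<Sum>j<n + 1. B $$ (n, j) * cofactor B n j)"
    by (rule laplace_expansion_row[OF B]) simp
  also have "\<dots> = (\<Sum>j\<in>{0}. B $$ (n, j) * cofactor B n j)"
  proof (rule sum.mono_neutral_right)
    show "\<forall>j\<in>{..<n + 1} - {0}. B $$ (n, j) * cofactor B n j = 0"
    proof
      fix j assume "j \<in> {..<n + 1} - {0}"
      then obtain k where "j = Suc k" "k < n"
        by (cases j) auto
      then show "B $$ (n, j) * cofactor B n j = 0"
        by (simp add: B_def shift orthogonal)
    qed
  qed auto
  also have "\<dots> = moment b (P n) * ((-1) ^ n * det (mat_delete B n 0))"
    by (simp add: B_def cofactor_def flip: one_pCons)
  also have "mat_delete B n 0 = mat n n (\<lambda>(i, j). moment a (monom 1 j * P i))"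
    by (rule eq_matI) (auto simp: mat_delete_def B_def shift)
  also have "det \<dots> = (\<Prod>i<n. moment a (monom 1 i * P i))"
    by (subst det_upper_triangular_mat) (auto simp: orthogonal)
  finally show ?thesis
    by (simp add: mult_ac)
qed

end

section \<open>The moment functional of the Euler polynomials at 1\<close>

text \<open>Compare coefficients of \<open>t ^ n\<close> in \<open>F(t) (e^t + 1) = 2 e^t\<close>
  and multiply by \<open>n!\<close>.\<close>

lemma euler_poly_1_recurrence:
  "(\<Sum>k\<le>n. of_nat (n choose k) * euler_poly k (1::'a::field_char_0)) + euler_poly n 1 = 2"
proof -
  have "fps_nth (Abs_fps (\<lambda>n. euler_poly n (1::'a) / fact n) * (fps_exp 1 + 1)) n
      = fps_nth (fps_const 2 * fps_exp 1) n"
    by (simp only: euler_gf_mult)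
  then have "(\<Sum>k\<le>n. euler_poly k (1::'a) / fact k / fact (n - k)) + euler_poly n 1 / fact n = 2 / fact n"
    by (simp add: distrib_left fps_mult_nth[of "Abs_fps f" for f] atLeast0AtMost)
  then have "fact n * ((\<Sum>k\<le>n. euler_poly k (1::'a) / fact k / fact (n - k)) + euler_poly n 1 / fact n) = 2"
    by simp
  then have "(\<Sum>k\<le>n. fact n * (euler_poly k (1::'a) / fact k / fact (n - k))) + euler_poly n 1 = 2"
    by (simp add: distrib_left sum_distrib_left)
  also have "(\<Sum>k\<le>n. fact n * (euler_poly k (1::'a) / fact k / fact (n - k)))
      = (\<Sum>k\<le>n. of_nat (n choose k) * euler_poly k 1)"
    by (intro sum.cong) (auto simp: binomial_fact)
  finally show ?thesis .
qed

abbreviation euler_moment :: "'a::field_char_0 poly \<Rightarrow> 'a" where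
  "euler_moment \<equiv> moment (\<lambda>k. euler_poly k 1)"

text \<open>By the binomial theorem this is the recurrence above; linearity then extends it to all
  polynomials.\<close>

lemma euler_moment_shift_monom:
  "euler_moment ([:1, 1:] ^ n) + euler_moment (monom 1 n) = (2::'a::field_char_0)"
proof -
  have "[:1, 1:] ^ n = (\<Sum>k\<le>n. monom (of_nat (n choose k)) k :: 'a poly)"
    using binomial_ring[of _ "1::'a" n]
    by (simp add: poly_eq_poly_eq_iff[symmetric] fun_eq_iff poly_sum poly_monom add.commute)
  then show ?thesis
    using euler_poly_1_recurrence[of n, where 'a = 'a]
    by (simp add: moment_sum moment_monom)
qed

lemma euler_moment_shift:
  fixes p :: "'a::field_char_0 poly"
  shows "euler_moment (p \<circ>\<^sub>p [:1, 1:]) + euler_moment p = 2 * poly p 1"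
proof -
  have "p \<circ>\<^sub>p [:1, 1:] = (\<Sum>k\<le>degree p. smult (coeff p k) ([:1, 1:] ^ k))"
    by (simp add: poly_eq_poly_eq_iff[symmetric] fun_eq_iff poly_pcompose poly_sum poly_altdef[of p])
  then have "euler_moment (p \<circ>\<^sub>p [:1, 1:]) + euler_moment p
      = (\<Sum>k\<le>degree p. coeff p k * (euler_moment ([:1, 1:] ^ k) + euler_moment (monom 1 k)))"
    by (simp add: moment_sum moment_smult sum.distrib distrib_left moment_monom moment_def[of _ p])
  then show ?thesis
    by (simp add: euler_moment_shift_monom poly_altdef sum_distrib_left mult.commute)
qed

text \<open>Up to an imaginary affine change of variable, these are the monic Meixner-Pollaczek
  polynomials with \<lambda> = 1/2 and \<phi> = \<pi>/2.\<close>

fun euler_op :: "nat \<Rightarrow> 'a::field_char_0 poly" where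
  "euler_op 0 = 1"
| "euler_op (Suc 0) = [:-1/2, 1:]"
| "euler_op (Suc (Suc n)) = [:-1/2, 1:] * euler_op (Suc n) + smult (of_nat (Suc n) ^ 2 / 4) (euler_op n)"

text \<open>At \<open>n = 0\<close> the truncated index \<open>n - 1\<close> is harmless because its
  coefficient vanishes.\<close>

lemma euler_op_Suc:
  "euler_op (Suc n) = [:-1/2, 1:] * euler_op n + smult (of_nat n ^ 2 / 4) (euler_op (n - 1))"
  by (cases n) simp_all

lemma degree_le_euler_op: "degree (euler_op n :: 'a::field_char_0 poly) \<le> n"
  and monic_euler_op: "coeff (euler_op n :: 'a poly) n = 1"
proof -
  have "degree (euler_op n :: 'a poly) \<le> n \<and> coeff (euler_op n :: 'a poly) n = 1"
  proof (induction n rule: euler_op.induct)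
    case (3 n)
    let ?P = "euler_op (Suc n) :: 'a poly" and ?Q = "euler_op n :: 'a poly"
    have "degree ([:-1/2, 1:] * ?P) \<le> Suc (Suc n)"
      using degree_mult_le[of "[:-1/2, 1:]" ?P] 3 by auto
    moreover have "degree (smult (of_nat (Suc n) ^ 2 / 4) ?Q) \<le> Suc (Suc n)"
      using 3 degree_smult_le[of _ ?Q] by (meson le_SucI le_trans)
    moreover have "coeff ?P (Suc (Suc n)) = 0" "coeff ?Q (Suc (Suc n)) = 0"
      using 3 by (auto intro!: coeff_eq_0)
    ultimately show ?case
      using 3 by (simp add: degree_add_le del: of_nat_Suc)
  qed auto
  then show "degree (euler_op n :: 'a poly) \<le> n" "coeff (euler_op n :: 'a poly) n = 1"
    by auto
qed

lemma degree_euler_op: "degree (euler_op n :: 'a::field_char_0 poly) = n"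
  using degree_le_euler_op monic_euler_op by (metis le_antisym le_degree zero_neq_one)

text \<open>Supplies the cancellation behind \<open>Q(0) = 0\<close>.\<close>

lemma poly_euler_op_0: "poly (euler_op n) (0::'a::field_char_0) = (-1/2) ^ n * fact n"
proof (induction n rule: euler_op.induct)
  case (3 n)
  show ?case
    by (simp only: euler_op.simps poly_add poly_mult poly_smult 3)
      (simp add: field_simps power2_eq_square)
qed auto

lemma euler_op_difference:
  fixes x :: "'a::field_char_0"
  shows "poly (euler_op (Suc n)) x - poly (euler_op (Suc n)) (x - 1) =
    of_nat (Suc n) / 2 * (poly (euler_op n) x + poly (euler_op n) (x - 1))"
proof (induction n rule: less_induct)
  case (less n)
  define P where "P k = poly (euler_op k) x" for k
  define R where "R k = poly (euler_op k) (x - 1)" for k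
  have rec: "P (Suc (Suc k)) = (x - 1/2) * P (Suc k) + of_nat (Suc k) ^ 2 / 4 * P k"
    "R (Suc (Suc k)) = (x - 3/2) * R (Suc k) + of_nat (Suc k) ^ 2 / 4 * R k" for k
    by (simp_all add: P_def R_def algebra_simps del: of_nat_Suc)
  have IH: "P (Suc k) - R (Suc k) = of_nat (Suc k) / 2 * (P k + R k)" if "k < n" for k
    using less.IH[OF that] by (simp add: P_def R_def)
  have init: "P 0 = 1" "R 0 = 1" "P (Suc 0) = x - 1/2" "R (Suc 0) = x - 3/2"
    by (simp_all add: P_def R_def)
  have "P (Suc n) - R (Suc n) = of_nat (Suc n) / 2 * (P n + R n)"
  proof (cases n)
    case 0
    then show ?thesis by (simp add: init)
  next
    case (Suc m)
    show ?thesis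
    \<comment> \<open>The general step uses the claim at \<open>n - 1\<close> and
      \<open>n - 2\<close>, so \<open>n = 1\<close> is computed directly.\<close>
    proof (cases m)
      case 0
      then show ?thesis
        using Suc by (simp add: rec init field_simps power2_eq_square)
    next
      case (Suc k)
      have n: "n = Suc (Suc k)"
        using Suc \<open>n = Suc m\<close> by simp
      define c :: 'a where "c = of_nat (Suc k)"
      have c: "of_nat (Suc (Suc k)) = c + 1" "of_nat (Suc (Suc (Suc k))) = c + 2"
        by (simp_all add: c_def)
      define S where "S = P k + R k"
      define S' where "S' = P (Suc k) + R (Suc k)"
      have D1: "P (Suc k) - R (Suc k) = c / 2 * S"
        using IH[of k] n by (simp add: S_def c_def)
      have D2: "P (Suc (Suc k)) - R (Suc (Suc k)) = (c + 1) / 2 * S'"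
        using IH[of "Suc k"] n by (simp only: c S'_def)
      \<comment> \<open>The factors \<open>x - 1/2\<close> and \<open>x - 3/2\<close> are
        \<open>(x - 1) + 1/2\<close> and \<open>(x - 1) - 1/2\<close>, so the recurrence mixes sums
        with differences. The induction hypotheses then reduce everything to \<open>S\<close> and
        \<open>S'\<close>.\<close>
      have "P (Suc (Suc k)) + R (Suc (Suc k)) =
          (x - 1) * S' + 1/2 * (P (Suc k) - R (Suc k)) + c ^ 2 / 4 * S"
        unfolding rec S_def S'_def c_def[symmetric] by (simp add: field_simps)
      then have S2: "P (Suc (Suc k)) + R (Suc (Suc k)) = (x - 1) * S' + c * (c + 1) / 4 * S"
        unfolding D1 by (simp add: field_simps power2_eq_square)
      have "P (Suc n) - R (Suc n) = (x - 1) * (P (Suc (Suc k)) - R (Suc (Suc k)))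
          + 1/2 * (P (Suc (Suc k)) + R (Suc (Suc k))) + (c + 1) ^ 2 / 4 * (P (Suc k) - R (Suc k))"
        unfolding n rec(1)[of "Suc k"] rec(2)[of "Suc k"] c by (simp add: field_simps)
      also have "\<dots> = (c + 2) / 2 * ((x - 1) * S' + c * (c + 1) / 4 * S)"
        unfolding D1 D2 S2 by (simp add: field_simps power2_eq_square)
      finally show ?thesis
        unfolding n c S2 .
    qed
  qed
  then show ?case by (simp add: P_def R_def)
qed

lemma euler_moment_euler_op:
  assumes "n > 0"
  shows "euler_moment (euler_op n) = (0::'a::field_char_0)"
proof -
  obtain m where n: "n = Suc m"
    using assms by (cases n) auto
  \<comment> \<open>Averaging \<open>P_n(x)\<close> with the difference identity solved for
    \<open>P_n(x)\<close> yields \<open>Q(x) + Q(x - 1)\<close>.\<close>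
  define Q :: "'a poly" where "Q = smult (1/2) (euler_op n + smult (of_nat n / 2) (euler_op m))"
  define R where "R = Q \<circ>\<^sub>p [:-1, 1:]"
  have "R \<circ>\<^sub>p [:1, 1:] = Q"
    by (simp add: R_def pcompose_pCons flip: pcompose_assoc)
  moreover have "euler_op n = Q + R"
  proof -
    have "poly (Q + R) x = poly (euler_op n) x" for x
    proof -
      have "poly (Q + R) x = 1/2 * (poly (euler_op n) x + poly (euler_op n) (x - 1)
          + of_nat n / 2 * (poly (euler_op m) x + poly (euler_op m) (x - 1)))"
        by (simp add: Q_def R_def poly_pcompose algebra_simps)
      also have "of_nat n / 2 * (poly (euler_op m) x + poly (euler_op m) (x - 1))
          = poly (euler_op n) x - poly (euler_op n) (x - 1)"
        unfolding n by (rule euler_op_difference[symmetric])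
      finally show ?thesis by simp
    qed
    then show ?thesis
      by (simp add: poly_eq_poly_eq_iff[symmetric] fun_eq_iff)
  qed
  \<comment> \<open>\<open>R(1) = Q(0)\<close>, where the two values from
    \<open>poly_euler_op_0\<close> cancel.\<close>
  moreover have "poly R 1 = 0"
    by (simp add: R_def Q_def poly_pcompose n poly_euler_op_0)
  ultimately show ?thesis
    using euler_moment_shift[of R] by (simp add: moment_add)
qed

text \<open>The three-term recurrence solved for \<open>x P_n\<close>: it trades a factor
  \<open>x\<close> for neighbouring indices, driving the inductions on the exponent.\<close>

lemma monom_mult_euler_op:
  "monom 1 (Suc j) * euler_op n = monom 1 j * euler_op (Suc n) + smult (1/2) (monom 1 j * euler_op n)
    + smult (- (of_nat n ^ 2 / 4)) (monom 1 j * euler_op (n - 1) :: 'a::field_char_0 poly)"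
proof -
  have "monom 1 (Suc j) = monom 1 j * [:0, 1::'a:]"
    by (simp add: monom_Suc)
  then show ?thesis
    by (subst euler_op_Suc) (simp add: algebra_simps smult_add_right)
qed

lemma euler_op_orthogonal:
  "j < n \<Longrightarrow> euler_moment (monom 1 j * euler_op n) = (0::'a::field_char_0)"
proof (induction j arbitrary: n)
  case 0
  then show ?case by (simp add: euler_moment_euler_op flip: one_pCons)
next
  case (Suc j)
  then show ?case
    by (simp only: monom_mult_euler_op moment_add moment_smult) (simp add: Suc)
qed

lemma euler_moment_1: "euler_moment 1 = (1::'a::field_char_0)"
  using euler_poly_1_recurrence[of 0, where 'a = 'a] by (simp add: moment_def)

text \<open>In the expansion of \<open>x ^ (n + 1) P_(n + 1)\<close>, orthogonality leaves only the
  lower neighbour, contributing the factor \<open>- (n + 1)^2 / 4\<close>.\<close>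

lemma euler_op_norm:
  "euler_moment (monom 1 n * euler_op n) = (-1/4) ^ n * (fact n ^ 2 :: 'a::field_char_0)"
proof (induction n)
  case 0
  then show ?case by (simp add: euler_moment_1 flip: one_pCons)
next
  case (Suc n)
  then show ?case
    by (simp only: monom_mult_euler_op moment_add moment_smult)
      (simp add: euler_op_orthogonal power_mult_distrib del: of_nat_Suc euler_op.simps)
qed

lemma monic_orthogonal_euler_op:
  "monic_orthogonal (\<lambda>k. euler_poly k (1::'a::field_char_0)) euler_op"
  by unfold_locales (simp_all add: degree_euler_op monic_euler_op euler_op_orthogonal)

section \<open>The shifted functional\<close>

lemma alt_harm_Suc: "alt_harm (Suc n) = alt_harm n + (-1) ^ n / real (Suc n)"
  by (simp add: alt_harm_def)

text \<open>The values \<open>P_n(0)\<close> solve the same recurrence; the moments are this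
  solution times \<open>- 2 * alt_harm n\<close>, as in reduction of order.\<close>

lemma shifted_moment_euler_op:
  fixes b :: "nat \<Rightarrow> real"
  assumes b0: "b 0 = 0" and b: "\<And>k. b (Suc k) = euler_poly k 1"
  shows "moment b (euler_op n) = - 2 * (-1/2) ^ n * fact n * alt_harm n"
proof (induction n rule: euler_op.induct)
  case 1
  then show ?case by (simp add: alt_harm_def moment_def b0)
next
  case 2
  then show ?case
    using euler_moment_1[where 'a = real] by (simp add: alt_harm_def moment_pCons b0 b one_pCons)
next
  case (3 n)
  \<comment> \<open>The \<open>x\<close>-part is split off because its \<open>b\<close>-moment is
    \<open>euler_moment (euler_op (Suc n))\<close>, which vanishes.\<close>
  have "euler_op (Suc (Suc n)) = pCons 0 (euler_op (Suc n)) + smult (-1/2) (euler_op (Suc n))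
      + smult (real (Suc n) ^ 2 / 4) (euler_op n)"
    by simp
  then have "moment b (euler_op (Suc (Suc n))) =
     - 1 / 2 * moment b (euler_op (Suc n)) + real (Suc n) ^ 2 / 4 * moment b (euler_op n)"
    by (simp only: moment_add moment_smult moment_pCons b0 b) (simp add: euler_moment_euler_op)
  also have "\<dots> = - 2 * (-1/2) ^ Suc (Suc n) * fact (Suc (Suc n)) * alt_harm (Suc (Suc n))"
  proof -
    define c where "c = real (Suc n)"
    have c: "c > 0" "real (Suc (Suc n)) = c + 1"
      by (simp_all add: c_def)
    show ?thesis
      unfolding 3 alt_harm_Suc fact_Suc c(2) c_def[symmetric] power_Suc of_nat_mult
      using c(1) by (simp add: divide_simps c_def[symmetric] del: of_nat_Suc)
        (simp add: algebra_simps power2_eq_square)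
  qed
  finally show ?case .
qed

theorem proposition3p2:
  fixes b :: "nat \<Rightarrow> real" and n :: nat
  assumes b_0: "b 0 = 0"
    and b_pos: "\<And>k. k \<ge> 1 \<Longrightarrow> b k = euler_poly (k - 1) 1"
    and n: "n \<ge> 1"
  shows "hankel_det b n =
    (-1) ^ (n - 1) * (2 ^ (n + 1) / fact n) * alt_harm n * hankel_det (\<lambda>k. euler_poly k 1) n"
proof -
  interpret monic_orthogonal "\<lambda>k. euler_poly k (1::real)" euler_op
    by (rule monic_orthogonal_euler_op)
  define H where "H = (\<Prod>i<n. euler_moment (monom 1 i * euler_op i) :: real)"
  have b: "b (Suc k) = euler_poly k 1" for k
    using b_pos[of "Suc k"] by simp
  have sgn: "(-1) ^ n = - ((-1) ^ (n - 1) :: real)"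
    using n by (cases n) auto
  have "hankel_det b n = (-1) ^ n * (- 2 * (-1/2) ^ n * fact n * alt_harm n) * H"
    using hankel_det_shifted[of b n] shifted_moment_euler_op[of b n] b_0 b
    by (simp add: H_def)
  moreover have "hankel_det (\<lambda>k. euler_poly k 1) n = H * ((-1/4) ^ n * fact n ^ 2)"
    unfolding hankel_det_eq_prod H_def euler_op_norm by (simp flip: lessThan_Suc_atMost)
  \<comment> \<open>Both determinants contain \<open>H\<close>; this identity matches the remaining
    powers and produces the factor \<open>2 ^ n\<close>.\<close>
  moreover have "2 ^ n * (-1/4) ^ n = ((-1/2) ^ n :: real)"
    by (simp flip: power_mult_distrib)
  ultimately show ?thesis
    unfolding sgn by (simp add: power2_eq_square)
qed

end
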